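(* For all integers $n,r$ with $2\le r\le n$, $$hk(\mathcal{K}(n,r)) = \binom{n}{r}-n+r,$$ where $\mathcal{K}(n,r)$ is the complete $r$-uniform hypergraph on $n$ vertices.
   Context: A hypergraph $\mathcal{H}$ consists of a finite nonempty vertex set $V(\mathcal{H})$ and a set $E(\mathcal{H})$ of subsets of $V(\mathcal{H})$ called hyperedges. All hypergraphs may have isolated vertices (vertices in no hyperedge) but have no loops, so every hyperedge has at least two vertices. The complete $r$-uniform hypergraph $\mathcal{K}(n,r)$ has $n$ vertices and its hyperedges are all the $r$-element subsets of the vertex set. For a finite set $I$ disjoint from $V(\mathcal{H})$, $\mathcal{H}\cup I$ is the hypergraph with vertex set $V(\mathcal{H})\cup I$ and hyperedge set $E(\mathcal{H})$. For a digraph $D$ and a vertex $v$, the in-neighborhood is $N_D^-(v)=\{x : (x,v)\in A(D)\}$. The competition hypergraph $C\mathcal{H}(D)$ of $D$ is the hypergraph with vertex set $V(D)$ in which $e\subseteq V(D)$ is a hyperedge if and only if $|e|\ge 2$ and $e=N_D^-(v)$ for some vertex $v$ of $D$. The hypercompetition number $hk(\mathcal{H})$ is the smallest integer $k\ge 0$ such that $\mathcal{H}\cup I$, where $I$ is a set of $k$ new isolated vertices, is the competition hypergraph of some acyclic digraph (one with no directed cycles, in particular no loops). *)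

theory Defs
  imports
    "HOL-Library.Infinite_Typeclass"
    "Graph_Theory.Pair_Digraph"
begin

record 'a hypergraph =
  hverts :: "'a set"
  hedges :: "'a set set"

definition wf_hypergraph :: "'a hypergraph \<Rightarrow> bool" where
  "wf_hypergraph H \<longleftrightarrow> finite (hverts H) \<and> hverts H \<noteq> {} \<and>
     (\<forall>e \<in> hedges H. e \<subseteq> hverts H \<and> card e \<ge> 2)"

definition complete_hypergraph :: "'a set \<Rightarrow> nat \<Rightarrow> 'a hypergraph" where
  "complete_hypergraph V r = \<lparr> hverts = V, hedges = {e. e \<subseteq> V \<and> card e = r} \<rparr>"

definition add_isolated :: "'a hypergraph \<Rightarrow> 'a set \<Rightarrow> 'a hypergraph" where
  "add_isolated H I = \<lparr> hverts = hverts H \<union> I, hedges = hedges H \<rparr>"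

definition in_nbhd :: "'a pair_pre_digraph \<Rightarrow> 'a \<Rightarrow> 'a set" where
  "in_nbhd D v = {x. (x, v) \<in> parcs D}"

definition competition_hypergraph :: "'a pair_pre_digraph \<Rightarrow> 'a hypergraph" where
  "competition_hypergraph D =
     \<lparr> hverts = pverts D,
       hedges = {e. e \<subseteq> pverts D \<and> card e \<ge> 2 \<and> (\<exists>v \<in> pverts D. e = in_nbhd D v)} \<rparr>"

text \<open>
  The library's cycles are nonempty closed walks without repeated vertices, and include loops
  and 2-cycles; so this excludes exactly the directed cycles of every length at least 1.
\<close>

definition acyclic_digraph :: "'a pair_pre_digraph \<Rightarrow> bool" where
  "acyclic_digraph D \<longleftrightarrow> (\<nexists>p. pre_digraph.cycle (with_proj D) p)"

definition isolated_realizable :: "'a hypergraph \<Rightarrow> nat \<Rightarrow> bool" where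
  "isolated_realizable H k \<longleftrightarrow>
     (\<exists>I D. finite I \<and> card I = k \<and> I \<inter> hverts H = {} \<and>
        pair_fin_digraph D \<and> acyclic_digraph D \<and>
        competition_hypergraph D = add_isolated H I)"

text \<open>
  The new vertices are taken from the vertex type itself, which is therefore required to be
  infinite, so that any number of them is available. The lemma \<open>isolated_realizable_hk\<close> below shows
  that the minimum is attained for every hypergraph.
\<close>

definition hk :: "'a::infinite hypergraph \<Rightarrow> nat" where
  "hk H = (LEAST k. isolated_realizable H k)"

lemma wf_complete_hypergraph:
  assumes "finite V" "2 \<le> r" "r \<le> card V"
  shows "wf_hypergraph (complete_hypergraph V r)"
  using assms by (auto simp: wf_hypergraph_def complete_hypergraph_def)

lemma isolated_realizable_card_hedges:
  fixes H :: "'a::infinite hypergraph"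
  assumes H: "wf_hypergraph H"
  shows "isolated_realizable H (card (hedges H))"
proof -
  have fin: "finite (hverts H)" and sub: "\<And>e. e \<in> hedges H \<Longrightarrow> e \<subseteq> hverts H"
    and two: "\<And>e. e \<in> hedges H \<Longrightarrow> 2 \<le> card e"
    using H by (auto simp: wf_hypergraph_def)
  have finE: "finite (hedges H)"
    by (rule finite_subset[of _ "Pow (hverts H)"]) (use fin sub in auto)
  have "infinite (- hverts H)"
    using fin infinite_UNIV by (simp add: finite_compl)
  then obtain I where I: "finite I" "card I = card (hedges H)" "I \<subseteq> - hverts H"
    using infinite_arbitrarily_large by blast
  then obtain f where f: "bij_betw f (hedges H) I"
    using finE finite_same_card_bij by metis
  have fI: "\<And>e. e \<in> hedges H \<Longrightarrow> f e \<in> I" and inj: "inj_on f (hedges H)"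
    and img: "f ` hedges H = I"
    using f by (auto simp: bij_betw_def)
  define D where "D = \<lparr> pverts = hverts H \<union> I,
    parcs = {(x, y). \<exists>e \<in> hedges H. x \<in> e \<and> y = f e} \<rparr>"
  have pA: "parcs D \<subseteq> hverts H \<times> I"
    using sub fI by (auto simp: D_def)
  have fD: "pair_fin_digraph D"
  proof
    show "finite (pverts D)" using fin I by (simp add: D_def)
    show "finite (parcs D)"
      by (rule finite_subset[OF pA]) (use fin I in simp)
    fix e assume "e \<in> parcs D"
    then have "e \<in> hverts H \<times> I" using pA by blast
    then show "fst e \<in> pverts D" "snd e \<in> pverts D"
      by (auto simp: D_def)
  qed
  have "acyclic_digraph D"
    unfolding acyclic_digraph_def
  proof
    assume "\<exists>p. pre_digraph.cycle (with_proj D) p"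
    then obtain p u where p: "pcas u p u" "set p \<subseteq> parcs D" "p \<noteq> []"
      by (auto simp: pre_digraph.cycle_def pre_digraph.awalk_def cas_with_proj_eq)
    have "u \<in> hverts H" using p pA by (cases p) auto
    moreover have "v \<in> I" if "pcas w q v" "set q \<subseteq> parcs D" "q \<noteq> []" for w q v
      using that
    proof (induction q arbitrary: w)
      case (Cons a q)
      then show ?case using pA by (cases "q = []") auto
    qed simp
    then have "u \<in> I" using p by blast
    ultimately show False using I by blast
  qed
  moreover have nb: "in_nbhd D (f e) = e" if "e \<in> hedges H" for e
    using that inj by (auto simp: in_nbhd_def D_def inj_on_def)
  have nb0: "in_nbhd D v = {}" if "v \<in> hverts H" for v
    using that subsetD[OF pA] I by (auto simp: in_nbhd_def)
  have "competition_hypergraph D = add_isolated H I"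
  proof -
    have "{e. e \<subseteq> pverts D \<and> card e \<ge> 2 \<and> (\<exists>v \<in> pverts D. e = in_nbhd D v)} = hedges H"
      (is "?L = _")
    proof
      show "?L \<subseteq> hedges H"
      proof
        fix e assume "e \<in> ?L"
        then obtain v where v: "v \<in> pverts D" "e = in_nbhd D v" "card e \<ge> 2" by blast
        then have "v \<in> I" using nb0[of v] by (auto simp: D_def)
        then show "e \<in> hedges H" using img nb v by auto
      qed
      show "hedges H \<subseteq> ?L"
      proof
        fix e assume e: "e \<in> hedges H"
        then have "f e \<in> pverts D" using fI by (simp add: D_def)
        moreover have "e \<subseteq> pverts D" using e sub by (auto simp: D_def)
        ultimately show "e \<in> ?L" using nb[OF e] two[OF e] by auto
      qed
    qed
    then show ?thesis
      by (simp add: competition_hypergraph_def add_isolated_def D_def)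
  qed
  ultimately show ?thesis
    unfolding isolated_realizable_def using I fD by blast
qed

lemma isolated_realizable_hk:
  fixes H :: "'a::infinite hypergraph"
  assumes "wf_hypergraph H"
  shows "isolated_realizable H (hk H)"
  unfolding hk_def
  by (rule LeastI) (rule isolated_realizable_card_hedges[OF assms])

end

theory Submission
  imports Defs
begin

text \<open>
  Realizing \<open>H\<close> with \<open>k\<close> extra isolated vertices means giving every hyperedge \<open>e\<close> its own vertex
  \<open>f e\<close> whose in-neighbourhood is \<open>e\<close>. The question is how many hyperedges can be served by the
  original vertices instead of new ones. List the \<open>n\<close> original vertices in a topological order
  \<open>v\<^sub>0, v\<^sub>1, \<dots>, v\<^sub>n\<^sub>-\<^sub>1\<close> of the digraph.

  A vertex with an \<open>r\<close>-subset of the list as in-neighbourhood has \<open>r\<close> predecessors in it, so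
  the first \<open>r\<close> vertices do not qualify (\<open>card_indegree_ge_le\<close>). Hence at most \<open>n - r\<close>
  hyperedges of the complete \<open>r\<close>-uniform hypergraph are served by original vertices, and the
  remaining \<open>(n choose r) - (n - r)\<close> need new ones (\<open>card_hedges_le_of_realizable\<close>).

  This count is attained: for any order of the vertices, give \<open>v\<^sub>i\<close> with \<open>i \<ge> r\<close> the block
  of the \<open>r\<close> vertices just before it (these blocks are distinct), and give every other
  \<open>r\<close>-subset a new vertex placed after all the original ones. All arcs go forward, so no cycle arises (\<open>isolated_realizableI_ranking\<close>,
  \<open>isolated_realizable_complete\<close>).
\<close>

lemma acyclic_digraph_iff_acyclic:
  assumes "pair_wf_digraph D"
  shows "acyclic_digraph D \<longleftrightarrow> acyclic (parcs D)"
proof -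
  interpret pair_wf_digraph D by fact
  have "(\<exists>p. cycle p) \<longleftrightarrow> (\<exists>p. closed_w p)"
    using closed_w_imp_cycle by (auto simp: cycle_def closed_w_def)
  also have "\<dots> \<longleftrightarrow> (\<exists>u. (u, u) \<in> (parcs D)\<^sup>+)"
    using reachable1_awalk by (auto simp: closed_w_def)
  finally show ?thesis
    by (auto simp: acyclic_digraph_def acyclic_def)
qed

text \<open>
  The first \<open>r\<close> vertices of a topological order have fewer than \<open>r\<close> predecessors. Instead of
  constructing the order, the induction removes a sink: this changes no in-neighbourhood within
  the remaining vertices and loses at most one vertex of large in-degree. It stops when at most
  \<open>r\<close> vertices are left, since a loopless vertex then has at most \<open>r - 1\<close> in-neighbours.
  The truncated subtraction is intended: for \<open>card V < r\<close> no vertex qualifies.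
\<close>

lemma card_indegree_ge_le:
  assumes "finite V" "acyclic R"
  shows "card {v \<in> V. r \<le> card {x \<in> V. (x, v) \<in> R}} \<le> card V - r"
  using assms(1)
proof (induction V rule: finite_psubset_induct)
  case (psubset V)
  let ?deg = "\<lambda>V v. card {x \<in> V. (x, v) \<in> R}"
  show ?case
  proof (cases "card V \<le> r")
    case True
    have "?deg V v < card V" if "v \<in> V" for v
    proof (rule psubset_card_mono)
      have "(v, v) \<notin> R" using assms(2) by (auto simp: acyclic_def)
      then show "{x \<in> V. (x, v) \<in> R} \<subset> V" using that by blast
    qed fact
    then have "{v \<in> V. r \<le> ?deg V v} = {}" using True by fastforce
    then show ?thesis by (simp only: card.empty)
  next
    case False
    then have "V \<noteq> {}" by auto
    have "wf ((R \<inter> V \<times> V)\<inverse>)"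
    proof (rule finite_acyclic_wf_converse)
      show "acyclic (R \<inter> V \<times> V)" using assms(2) by (rule acyclic_subset) blast
    qed (use psubset.hyps in blast)
    then obtain s where "s \<in> V" and min: "\<And>y. (y, s) \<in> (R \<inter> V \<times> V)\<inverse> \<Longrightarrow> y \<notin> V"
      using \<open>V \<noteq> {}\<close> by (rule wfE_min') (rule that)
    have s: "s \<in> V" "\<And>y. y \<in> V \<Longrightarrow> (s, y) \<notin> R"
      using \<open>s \<in> V\<close> min by blast+
    let ?W = "V - {s}"
    have "{x \<in> V. (x, v) \<in> R} = {x \<in> ?W. (x, v) \<in> R}" if "v \<in> V" for v
      using s(2)[OF that] by blast
    then have "{v \<in> V. r \<le> ?deg V v} \<subseteq> insert s {v \<in> ?W. r \<le> ?deg ?W v}"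
      by auto
    then have "card {v \<in> V. r \<le> ?deg V v} \<le> card (insert s {v \<in> ?W. r \<le> ?deg ?W v})"
      using psubset.hyps by (intro card_mono) auto
    also have "\<dots> \<le> Suc (card {v \<in> ?W. r \<le> ?deg ?W v})"
      by (rule card_insert_le_m1) auto
    also have "\<dots> \<le> Suc (card ?W - r)"
      unfolding Suc_le_mono using s(1) by (intro psubset.IH) blast
    also have "\<dots> = card V - r"
      using False s(1) psubset.hyps by simp
    finally show ?thesis .
  qed
qed

text \<open>
  Distinct hyperedges are in-neighbourhoods of distinct vertices, and those of these vertices
  that are not new have in-degree at least \<open>r\<close> within \<open>hverts H\<close>.
\<close>

lemma card_hedges_le_of_realizable:
  assumes H: "wf_hypergraph H" and r: "\<And>e. e \<in> hedges H \<Longrightarrow> r \<le> card e"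
    and real: "isolated_realizable H k"
  shows "card (hedges H) \<le> k + (card (hverts H) - r)"
proof -
  obtain I D where I: "finite I" "card I = k"
    and D: "pair_fin_digraph D" "acyclic_digraph D"
    and comp: "competition_hypergraph D = add_isolated H I"
    using real unfolding isolated_realizable_def by blast
  have fin: "finite (hverts H)" and sub: "\<And>e. e \<in> hedges H \<Longrightarrow> e \<subseteq> hverts H"
    using H by (auto simp: wf_hypergraph_def)
  interpret pair_fin_digraph D by fact
  have "acyclic (parcs D)"
    using D(2) acyclic_digraph_iff_acyclic[OF pair_wf_digraph_axioms] by simp
  let ?L = "{v \<in> hverts H. r \<le> card {x \<in> hverts H. (x, v) \<in> parcs D}}"
  have "hedges H \<subseteq> in_nbhd D ` (I \<union> ?L)"
  proof
    fix e assume e: "e \<in> hedges H"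
    then have "e \<in> hedges (competition_hypergraph D)"
      using comp by (simp add: add_isolated_def)
    then obtain v where v: "v \<in> pverts D" "e = in_nbhd D v"
      by (auto simp: competition_hypergraph_def)
    have "{x \<in> hverts H. (x, v) \<in> parcs D} = e"
      using v(2) sub[OF e] by (auto simp: in_nbhd_def)
    moreover have "v \<in> hverts H \<union> I"
      using v(1) comp by (simp add: competition_hypergraph_def add_isolated_def)
    ultimately have "v \<in> I \<union> ?L" using r[OF e] by auto
    then show "e \<in> in_nbhd D ` (I \<union> ?L)" using v(2) by blast
  qed
  then have "card (hedges H) \<le> card (I \<union> ?L)"
    using I(1) fin by (intro surj_card_le) auto
  also have "\<dots> \<le> card I + card ?L" by (rule card_Un_le)
  also have "card ?L \<le> card (hverts H) - r"
    by (rule card_indegree_ge_le) fact+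
  finally show ?thesis using I(2) by simp
qed

text \<open>
  Given an assignment \<open>f\<close> of vertices to hyperedges, draw arcs to \<open>f e\<close> from exactly the
  members of \<open>e\<close>. As \<open>f\<close> is injective, arcs drawn for different hyperedges do not end in a
  common vertex; the ranking, along which all arcs ascend, excludes cycles.
\<close>

lemma isolated_realizableI_ranking:
  fixes rank :: "'a \<Rightarrow> nat"
  assumes H: "wf_hypergraph H" and I: "finite I" "I \<inter> hverts H = {}"
    and inj: "inj_on f (hedges H)"
    and f: "\<And>e. e \<in> hedges H \<Longrightarrow> f e \<in> hverts H \<union> I"
    and rank: "\<And>e x. e \<in> hedges H \<Longrightarrow> x \<in> e \<Longrightarrow> rank x < rank (f e)"
  shows "isolated_realizable H (card I)"
proof -
  have fin: "finite (hverts H)" and sub: "\<And>e. e \<in> hedges H \<Longrightarrow> e \<subseteq> hverts H"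
    and two: "\<And>e. e \<in> hedges H \<Longrightarrow> 2 \<le> card e"
    using H by (auto simp: wf_hypergraph_def)
  define D where "D = \<lparr> pverts = hverts H \<union> I,
    parcs = {(x, y). \<exists>e \<in> hedges H. x \<in> e \<and> y = f e} \<rparr>"
  have arcs: "parcs D \<subseteq> (hverts H \<union> I) \<times> (hverts H \<union> I)"
    using sub f by (auto simp: D_def)
  have D: "pair_fin_digraph D"
  proof
    show "finite (pverts D)" using fin I by (simp add: D_def)
    show "finite (parcs D)"
      using arcs by (rule finite_subset) (use fin I in simp)
    fix e assume "e \<in> parcs D"
    then have "e \<in> (hverts H \<union> I) \<times> (hverts H \<union> I)" using arcs by blast
    then show "fst e \<in> pverts D" "snd e \<in> pverts D"
      by (auto simp: D_def)
  qed
  have "parcs D \<subseteq> measure rank"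
    using rank by (auto simp: D_def)
  then have "acyclic (parcs D)"
    by (rule acyclic_subset[OF wf_acyclic[OF wf_measure]])
  then have acyc: "acyclic_digraph D"
    using acyclic_digraph_iff_acyclic[OF pair_fin_digraph.axioms(1)[OF D]] by simp
  have nbhd: "in_nbhd D (f e) = e" if "e \<in> hedges H" for e
    using that inj by (auto simp: in_nbhd_def D_def inj_on_def)
  have nbhd_empty: "in_nbhd D v = {}" if "v \<notin> f ` hedges H" for v
    using that by (auto simp: in_nbhd_def D_def)
  have "e \<in> hedges H"
    if "card e \<ge> 2" "e = in_nbhd D v" for e v
  proof -
    have "v \<in> f ` hedges H" using that nbhd_empty[of v] by fastforce
    then show ?thesis using that(2) nbhd by auto
  qed
  moreover have "e \<subseteq> pverts D \<and> f e \<in> pverts D" if "e \<in> hedges H" for e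
    using that sub f by (auto simp: D_def)
  ultimately have
    "{e. e \<subseteq> pverts D \<and> card e \<ge> 2 \<and> (\<exists>v \<in> pverts D. e = in_nbhd D v)} = hedges H"
    using nbhd two by blast
  then have "competition_hypergraph D = add_isolated H I"
    by (simp add: competition_hypergraph_def add_isolated_def D_def)
  then show ?thesis
    unfolding isolated_realizable_def using I D acyc by blast
qed

text \<open>
  Numbering the vertices by \<open>v\<close>, the block of \<open>v i\<close> consists of the \<open>r\<close> vertices just before it.
  Blocks are assigned to original vertices and all other hyperedges, bijectively, to new ones.
  Since the blocks are distinct \<open>r\<close>-subsets, the subtraction does not truncate.
\<close>

lemma isolated_realizable_complete:
  fixes V :: "'a::infinite set"
  assumes V: "finite V" and r: "2 \<le> r" "r \<le> card V"
  shows "card V - r \<le> card V choose r"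
    and "isolated_realizable (complete_hypergraph V r) ((card V choose r) - (card V - r))"
proof -
  define n where "n = card V"
  let ?H = "complete_hypergraph V r"
  define E where "E = {e. e \<subseteq> V \<and> card e = r}"
  have edges: "hedges ?H = E" and verts: "hverts ?H = V"
    by (simp_all add: complete_hypergraph_def E_def)
  have finE: "finite E" and cardE: "card E = n choose r"
    using V by (auto simp: E_def n_def n_subsets)
  obtain v where v: "bij_betw v {0..<n} V"
    using ex_bij_betw_nat_finite[OF V] n_def by blast
  have v_inj: "inj_on v {0..<n}" and v_img: "v ` {0..<n} = V"
    using v by (auto simp: bij_betw_def)
  define block where "block i = v ` {i - r..<i}" for i
  have block_E: "block ` {r..<n} \<subseteq> E"
  proof clarify
    fix i assume i: "i \<in> {r..<n}"
    then have "{i - r..<i} \<subseteq> {0..<n}" by auto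
    then have "card (block i) = card {i - r..<i}" "block i \<subseteq> V"
      unfolding block_def using v_img card_image[OF inj_on_subset[OF v_inj]] by blast+
    then show "block i \<in> E" using i by (simp add: E_def)
  qed
  have block_inj: "inj_on block {r..<n}"
  proof (rule inj_onI)
    fix i j assume ij: "i \<in> {r..<n}" "j \<in> {r..<n}" "block i = block j"
    have "{i - r..<i} = {j - r..<j}"
      using inj_on_image_eq_iff[OF v_inj, of "{i - r..<i}" "{j - r..<j}"] ij
      by (auto simp: block_def)
    then show "i = j" using ij r(1) by (simp add: atLeastLessThan_eq_iff)
  qed
  have card_blocks: "card (block ` {r..<n}) = n - r"
    using card_image[OF block_inj] by simp
  then show "card V - r \<le> card V choose r"
    using card_mono[OF finE block_E] cardE n_def by simp
  have "infinite (- V)"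
    using V infinite_UNIV by (simp add: finite_compl)
  then obtain I where I: "finite I" "card I = card (E - block ` {r..<n})" "I \<subseteq> - V"
    using infinite_arbitrarily_large by blast
  then obtain h where h: "bij_betw h (E - block ` {r..<n}) I"
    using finE finite_same_card_bij by (metis finite_Diff)
  define f where
    "f e = (if e \<in> block ` {r..<n} then v (the_inv_into {r..<n} block e) else h e)" for e
  define rank where "rank x = (if x \<in> V then the_inv_into {0..<n} v x else n)" for x
  have f_block: "f (block i) = v i" if "i \<in> {r..<n}" for i
    using that by (simp add: f_def the_inv_into_f_f[OF block_inj])
  have f_other: "f e \<in> I" if "e \<in> E" "e \<notin> block ` {r..<n}" for e
    using that h by (auto simp: f_def bij_betw_def)
  have v_V: "v i \<in> V" if "i < n" for i
    using that v_img by auto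
  have rank_v: "rank (v i) = i" if "i < n" for i
    using that v_V by (simp add: rank_def the_inv_into_f_f[OF v_inj])
  have rank_less: "rank x < n" if "x \<in> V" for x
    using that v_img rank_v by auto
  have "isolated_realizable ?H (card I)"
  proof (rule isolated_realizableI_ranking)
    show "wf_hypergraph ?H" using V r by (rule wf_complete_hypergraph)
    show "finite I" "I \<inter> hverts ?H = {}" using I verts by auto
    have "inj_on f (block ` {r..<n} \<union> (E - block ` {r..<n}))"
      unfolding inj_on_Un
    proof (intro conjI)
      show "inj_on f (block ` {r..<n})"
        by (auto intro!: inj_onI simp: f_block inj_on_eq_iff[OF v_inj])
      show "inj_on f (E - block ` {r..<n})"
        using h by (auto simp: bij_betw_def f_def inj_on_def)
      have "f ` block ` {r..<n} \<subseteq> V" "f ` (E - block ` {r..<n}) \<subseteq> I"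
        using f_block f_other v_V by auto
      then show "f ` (block ` {r..<n} - (E - block ` {r..<n})) \<inter>
          f ` (E - block ` {r..<n} - block ` {r..<n}) = {}"
        using I(3) by blast
    qed
    moreover have "block ` {r..<n} \<union> (E - block ` {r..<n}) = E" using block_E by blast
    ultimately show "inj_on f (hedges ?H)" using edges by simp
    fix e assume "e \<in> hedges ?H"
    then have e: "e \<in> E" by (simp only: edges)
    show "f e \<in> hverts ?H \<union> I"
      using f_block f_other[OF e] v_V verts by (cases "e \<in> block ` {r..<n}") auto
    fix x assume x: "x \<in> e"
    show "rank x < rank (f e)"
    proof (cases "e \<in> block ` {r..<n}")
      case True
      then obtain i where i: "i \<in> {r..<n}" "e = block i" by blast
      then obtain j where "x = v j" "j < i" using x by (auto simp: block_def)
      then show ?thesis using i rank_v f_block by simp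
    next
      case False
      then have "rank (f e) = n" using f_other[OF e] I(3) by (auto simp: rank_def)
      moreover have "x \<in> V" using e x by (auto simp: E_def)
      ultimately show ?thesis using rank_less by simp
    qed
  qed
  moreover have "card I = (n choose r) - (n - r)"
    using I(2) card_Diff_subset[OF _ block_E] card_blocks cardE by simp
  ultimately show "isolated_realizable ?H ((card V choose r) - (card V - r))"
    by (simp add: n_def)
qed

theorem corollary2p7:
  fixes V :: "'a::infinite set" and n r :: nat
  assumes "finite V" and "card V = n" and "2 \<le> r" and "r \<le> n"
  shows "int (hk (complete_hypergraph V r)) = int (n choose r) - int n + int r"
proof -
  let ?H = "complete_hypergraph V r"
  have card_edges: "card (hedges ?H) = n choose r" and verts: "hverts ?H = V"
    using assms by (simp_all add: complete_hypergraph_def n_subsets)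
  have "hk ?H = (n choose r) - (n - r)"
    unfolding hk_def
  proof (rule Least_equality)
    show "isolated_realizable ?H ((n choose r) - (n - r))"
      using isolated_realizable_complete(2)[of V r] assms by simp
    fix k assume "isolated_realizable ?H k"
    then have "card (hedges ?H) \<le> k + (card (hverts ?H) - r)"
      using assms wf_complete_hypergraph[of V r]
      by (intro card_hedges_le_of_realizable) (auto simp: complete_hypergraph_def)
    then show "(n choose r) - (n - r) \<le> k"
      using card_edges verts assms(2) by simp
  qed
  moreover have "n - r \<le> n choose r"
    using isolated_realizable_complete(1)[of V r] assms by simp
  ultimately show ?thesis using assms(4) by linarith
qed

end
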